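(* Let $\mathcal{P}=\mathcal{P}(\mathbb{C}^2\otimes\mathbb{C}^2\otimes\mathbb{C}^2)=\mathbb{C}[x_{ijk}:i,j,k\in\{1,2\}]$ with the action of $G=GL_2(\mathbb{C})^3$ described in the context, and let $N\subset G$ be the product of the three groups of unipotent upper triangular matrices. Let $d_{12},d_{13},d_{23},f_3,f_4\in\mathcal{P}$ be the polynomials defined in the context. Then the monomials $$x_{111}^a\, d_{12}^b\, d_{13}^c\, d_{23}^d\, f_3^e\, f_4^g,\qquad a,b,c,d,g\in\mathbb{Z}_{\ge 0},\ e\in\{0,1\},$$ form a vector space basis for the algebra $\mathcal{P}^N$ of $N$-invariants in $\mathcal{P}$. In particular, this algebra is generated by $x_{111},d_{12},d_{13},d_{23},f_3$ and $f_4$, with the only relation being $$f_3^2=x_{111}^2f_4-4d_{12}d_{13}d_{23},$$ i.e. the ideal of all polynomial relations among these six generators is the principal ideal generated by this one.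
   Context: Action: $G=GL_2\times GL_2\times GL_2$ acts on $\mathcal{P}$ by algebra automorphisms so that the linear span of the variables $x_{ijk}$ is the $G$-module $\mathbb{C}^2\otimes\mathbb{C}^2\otimes\mathbb{C}^2$ with $x_{ijk}$ corresponding to $e_i\otimes e_j\otimes e_k$. At the Lie algebra level, for $r\in\{1,2,3\}$, $e_{12}^{(r)}$ acts as the derivation of $\mathcal{P}$ which changes the $r$-th index $2$ of a variable to $1$ and kills variables with $r$-th index $1$. A polynomial is $N$-invariant iff it is annihilated by $e_{12}^{(1)},e_{12}^{(2)},e_{12}^{(3)}$. Polynomials: $d_{12}=x_{111}x_{221}-x_{121}x_{211}$, $d_{13}=x_{111}x_{212}-x_{112}x_{211}$, $d_{23}=x_{111}x_{122}-x_{112}x_{121}$; $f_3=x_{111}^2x_{222}-x_{111}x_{112}x_{221}-x_{111}x_{121}x_{212}-x_{111}x_{122}x_{211}+2x_{112}x_{121}x_{211}$; $f_4=x_{111}^2x_{222}^2-2x_{111}x_{112}x_{221}x_{222}-2x_{111}x_{121}x_{212}x_{222}-2x_{111}x_{122}x_{211}x_{222}+4x_{111}x_{122}x_{212}x_{221}+x_{112}^2x_{221}^2+4x_{112}x_{121}x_{211}x_{222}-2x_{112}x_{121}x_{212}x_{221}-2x_{112}x_{122}x_{211}x_{221}+x_{121}^2x_{212}^2-2x_{121}x_{122}x_{211}x_{212}+x_{122}^2x_{211}^2$. *)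

theory Defs
  imports "HOL-Library.Poly_Mapping" "HOL-Analysis.Determinants"
begin

section \<open>Complex polynomials in a set of variables\<close>

text \<open>
  The polynomial ring over the complex numbers with variables of type \<open>'v\<close> is the monoid
  algebra of the free commutative monoid \<^typ>\<open>'v \<Rightarrow>\<^sub>0 nat\<close> of exponent vectors.
\<close>

type_synonym 'v cpoly = "('v \<Rightarrow>\<^sub>0 nat) \<Rightarrow>\<^sub>0 complex"

definition Const :: "complex \<Rightarrow> 'v cpoly" where
  "Const c = Poly_Mapping.single 0 c"

definition Var :: "'v \<Rightarrow> 'v cpoly" where
  "Var v = Poly_Mapping.single (Poly_Mapping.single v 1) 1"

definition smult :: "complex \<Rightarrow> 'v cpoly \<Rightarrow> 'v cpoly" where
  "smult c p = Const c * p"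

lemma Const_0: "Const 0 = 0"
  and Const_1: "Const 1 = 1"
  and Const_add: "Const (c + d) = Const c + Const d"
  and Const_mult: "Const (c * d) = Const c * Const d"
  by (simp_all add: Const_def single_add mult_single)

interpretation cpoly: vector_space "smult :: complex \<Rightarrow> 'v cpoly \<Rightarrow> 'v cpoly"
  by standard (simp_all add: smult_def Const_add Const_mult Const_1 algebra_simps)

definition subalgebra :: "'v cpoly set \<Rightarrow> bool" where
  "subalgebra A \<longleftrightarrow> cpoly.subspace A \<and> 1 \<in> A \<and> (\<forall>p\<in>A. \<forall>q\<in>A. p * q \<in> A)"

text \<open>The algebra homomorphism sending each variable \<open>v\<close> to \<open>f v\<close>.\<close>

definition subst_monom :: "('v \<Rightarrow> 'w cpoly) \<Rightarrow> ('v \<Rightarrow>\<^sub>0 nat) \<Rightarrow> 'w cpoly" where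
  "subst_monom f m = (\<Prod>v\<in>Poly_Mapping.keys m. f v ^ Poly_Mapping.lookup m v)"

definition subst :: "('v \<Rightarrow> 'w cpoly) \<Rightarrow> 'v cpoly \<Rightarrow> 'w cpoly" where
  "subst f p = (\<Sum>m\<in>Poly_Mapping.keys p. smult (Poly_Mapping.lookup p m) (subst_monom f m))"

lemma subst_superset:
  assumes "finite S" "Poly_Mapping.keys p \<subseteq> S"
  shows "subst f p = (\<Sum>m\<in>S. smult (Poly_Mapping.lookup p m) (subst_monom f m))"
  unfolding subst_def using assms
  by (intro sum.mono_neutral_left) (auto simp: in_keys_iff)

lemma subst_add: "subst f (p + q) = subst f p + subst f q"
proof -
  let ?S = "Poly_Mapping.keys p \<union> Poly_Mapping.keys q"
  have "Poly_Mapping.keys (p + q) \<subseteq> ?S" by (rule Poly_Mapping.keys_add)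
  then show ?thesis
    by (simp add: subst_superset[of ?S] lookup_add cpoly.scale_left_distrib sum.distrib)
qed

lemma subst_0: "subst f 0 = 0"
  by (simp add: subst_def)

lemma subst_single: "subst f (Poly_Mapping.single m c) = smult c (subst_monom f m)"
  by (cases "c = 0") (simp_all add: subst_def)

lemma subst_monom_superset:
  assumes "finite S" "Poly_Mapping.keys m \<subseteq> S"
  shows "subst_monom f m = (\<Prod>v\<in>S. f v ^ Poly_Mapping.lookup m v)"
  unfolding subst_monom_def using assms
  by (intro prod.mono_neutral_left) (auto simp: in_keys_iff)

lemma subst_monom_add: "subst_monom f (m + n) = subst_monom f m * subst_monom f n"
proof -
  let ?S = "Poly_Mapping.keys m \<union> Poly_Mapping.keys n"
  have "Poly_Mapping.keys (m + n) \<subseteq> ?S" by (rule Poly_Mapping.keys_add)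
  then show ?thesis
    by (simp add: subst_monom_superset[of ?S] lookup_add power_add prod.distrib)
qed

lemma subst_Const: "subst f (Const c) = Const c"
  by (simp add: Const_def subst_single subst_monom_def) (simp add: smult_def Const_def)

lemma subst_1: "subst f 1 = 1"
  by (metis subst_Const Const_1)

lemma subst_Var: "subst f (Var v) = f v"
  by (simp add: Var_def subst_single subst_monom_def)

lemma cpoly_induct [case_names 0 add]:
  fixes p :: "'v cpoly"
  assumes "P 0" and "\<And>m c p. P p \<Longrightarrow> P (Poly_Mapping.single m c + p)"
  shows "P p"
proof (induction p rule: update_induct)
  case const
  then show ?case by (rule assms(1))
next
  case (update p m c)
  have "Poly_Mapping.update m c p = Poly_Mapping.single m c + p"
    using update.hyps(1)
    by (intro poly_mapping_eqI)
       (auto simp: lookup_update lookup_add lookup_single in_keys_iff when_def)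
  then show ?case using update.IH assms(2) by simp
qed

lemma subst_mult: "subst f (p * q) = subst f p * subst f q"
proof (induction p rule: cpoly_induct)
  case 0
  then show ?case by (simp add: subst_0)
next
  case (add m c p)
  have "subst f (Poly_Mapping.single m c * q) = subst f (Poly_Mapping.single m c) * subst f q"
    by (induction q rule: cpoly_induct)
       (simp_all add: subst_0 subst_add subst_single mult_single subst_monom_add smult_def
          Const_mult algebra_simps)
  then show ?case using add.IH by (simp add: subst_add algebra_simps)
qed

lemma subst_smult: "subst f (smult c p) = smult c (subst f p)"
  by (simp add: smult_def subst_mult subst_Const)


section \<open>The action of \<open>GL\<^sub>2 \<times> GL\<^sub>2 \<times> GL\<^sub>2\<close>\<close>

text \<open>
  The variables are indexed by triples of elements of the two-element type \<^typ>\<open>2\<close>; its elements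
  are \<open>1\<close> and \<open>2\<close> (where \<open>2 = 0\<close>).
\<close>

type_synonym index = "2 \<times> 2 \<times> 2"

abbreviation X :: "2 \<Rightarrow> 2 \<Rightarrow> 2 \<Rightarrow> index cpoly" where
  "X i j k \<equiv> Var (i, j, k)"

type_synonym mat2 = "complex ^ 2 ^ 2"

definition GL2 :: "mat2 set" where
  "GL2 = {A. invertible A}"

definition U2 :: "mat2 set" where
  "U2 = {A. A $ 1 $ 1 = 1 \<and> A $ 2 $ 2 = 1 \<and> A $ 2 $ 1 = 0}"

definition G :: "(mat2 \<times> mat2 \<times> mat2) set" where
  "G = GL2 \<times> GL2 \<times> GL2"

definition N :: "(mat2 \<times> mat2 \<times> mat2) set" where
  "N = U2 \<times> U2 \<times> U2"

lemma N_subset_G: "N \<subseteq> G"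
proof -
  have "U2 \<subseteq> GL2"
    by (auto simp: U2_def GL2_def invertible_det_nz det_2)
  then show ?thesis by (auto simp: N_def G_def)
qed

text \<open>
  A matrix \<open>A\<close> maps the basis vector \<open>e\<^sub>i\<close> to the sum of the \<open>A $ p $ i\<close> times \<open>e\<^sub>p\<close>, and
  \<open>X i j k\<close> corresponds to the tensor product of \<open>e\<^sub>i\<close>, \<open>e\<^sub>j\<close> and \<open>e\<^sub>k\<close>.
\<close>

fun act :: "mat2 \<times> mat2 \<times> mat2 \<Rightarrow> index cpoly \<Rightarrow> index cpoly" where
  "act (A, B, C) = subst (\<lambda>(i, j, k).
     \<Sum>p\<in>UNIV. \<Sum>q\<in>UNIV. \<Sum>r\<in>UNIV. smult (A $ p $ i * B $ q $ j * C $ r $ k) (X p q r))"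

definition invariants :: "(mat2 \<times> mat2 \<times> mat2) set \<Rightarrow> index cpoly set" where
  "invariants H = {p. \<forall>g\<in>H. act g p = p}"


section \<open>The generators and their relations\<close>

definition d12 :: "index cpoly" where
  "d12 = X 1 1 1 * X 2 2 1 - X 1 2 1 * X 2 1 1"

definition d13 :: "index cpoly" where
  "d13 = X 1 1 1 * X 2 1 2 - X 1 1 2 * X 2 1 1"

definition d23 :: "index cpoly" where
  "d23 = X 1 1 1 * X 1 2 2 - X 1 1 2 * X 1 2 1"

definition f3 :: "index cpoly" where
  "f3 = X 1 1 1 ^ 2 * X 2 2 2 - X 1 1 1 * X 1 1 2 * X 2 2 1 - X 1 1 1 * X 1 2 1 * X 2 1 2
      - X 1 1 1 * X 1 2 2 * X 2 1 1 + 2 * X 1 1 2 * X 1 2 1 * X 2 1 1"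

definition f4 :: "index cpoly" where
  "f4 = X 1 1 1 ^ 2 * X 2 2 2 ^ 2
      - 2 * X 1 1 1 * X 1 1 2 * X 2 2 1 * X 2 2 2
      - 2 * X 1 1 1 * X 1 2 1 * X 2 1 2 * X 2 2 2
      - 2 * X 1 1 1 * X 1 2 2 * X 2 1 1 * X 2 2 2
      + 4 * X 1 1 1 * X 1 2 2 * X 2 1 2 * X 2 2 1
      + X 1 1 2 ^ 2 * X 2 2 1 ^ 2
      + 4 * X 1 1 2 * X 1 2 1 * X 2 1 1 * X 2 2 2
      - 2 * X 1 1 2 * X 1 2 1 * X 2 1 2 * X 2 2 1
      - 2 * X 1 1 2 * X 1 2 2 * X 2 1 1 * X 2 2 1
      + X 1 2 1 ^ 2 * X 2 1 2 ^ 2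
      - 2 * X 1 2 1 * X 1 2 2 * X 2 1 1 * X 2 1 2
      + X 1 2 2 ^ 2 * X 2 1 1 ^ 2"

fun gen_monomial :: "nat \<times> nat \<times> nat \<times> nat \<times> nat \<times> nat \<Rightarrow> index cpoly" where
  "gen_monomial (a, b, c, d, e, g) = X 1 1 1 ^ a * d12 ^ b * d13 ^ c * d23 ^ d * f3 ^ e * f4 ^ g"

definition basis_exponents :: "(nat \<times> nat \<times> nat \<times> nat \<times> nat \<times> nat) set" where
  "basis_exponents = {(a, b, c, d, e, g). e \<in> {0, 1}}"

text \<open>
  Names of the six generators; polynomials in these serve as the abstract polynomial ring in which
  the relations live.
\<close>

datatype gen = X111 | D12 | D13 | D23 | F3 | F4

fun gen_value :: "gen \<Rightarrow> index cpoly" where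
  "gen_value X111 = X 1 1 1"
| "gen_value D12 = d12"
| "gen_value D13 = d13"
| "gen_value D23 = d23"
| "gen_value F3 = f3"
| "gen_value F4 = f4"

definition relation_ideal :: "gen cpoly set" where
  "relation_ideal = {p. subst gen_value p = 0}"

definition principal_ideal :: "'v cpoly \<Rightarrow> 'v cpoly set" where
  "principal_ideal r = {q * r | q. True}"

end

theory Submission
  imports Defs
begin

text \<open>
  Where \<open>x\<^sub>1\<^sub>1\<^sub>1 \<noteq> 0\<close>, every \<open>N\<close>-orbit meets the slice \<open>x\<^sub>1\<^sub>1\<^sub>2 = x\<^sub>1\<^sub>2\<^sub>1 = x\<^sub>2\<^sub>1\<^sub>1 = 0\<close> in a point
  whose remaining coordinates are \<open>x\<^sub>1\<^sub>1\<^sub>1\<close>, the \<open>d\<^sub>i\<^sub>j / x\<^sub>1\<^sub>1\<^sub>1\<close> and \<open>f\<^sub>3 / x\<^sub>1\<^sub>1\<^sub>1\<^sup>2\<close>. Hence a power of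
  \<open>x\<^sub>1\<^sub>1\<^sub>1\<close> times any invariant is a polynomial in the generators. The power can be cancelled
  because of what happens on the subspace \<open>x\<^sub>1\<^sub>1\<^sub>1 = x\<^sub>1\<^sub>2\<^sub>2 = x\<^sub>2\<^sub>1\<^sub>2 = x\<^sub>2\<^sub>2\<^sub>1 = 0\<close>: there the other five
  generators become scalar multiples of monomials, and the products with \<open>e \<in> {0, 1}\<close> become scalar
  multiples of pairwise distinct monomials. A combination of basis elements that is divisible by
  \<open>x\<^sub>1\<^sub>1\<^sub>1\<close> therefore only involves basis elements with \<open>a > 0\<close>. The same fact yields linear
  independence, and with it the ideal of relations.
\<close>

section \<open>Evaluation of polynomials\<close>

lemma Const_eq_iff: "Const c = Const d \<longleftrightarrow> c = d"
  by (metis Const_def lookup_single_eq)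

lemma subst_minus: "subst f (- p) = - subst f p"
  by (metis add.right_inverse add_eq_0_iff subst_0 subst_add)

lemma subst_diff: "subst f (p - q) = subst f p - subst f q"
  using subst_add[of f p "- q"] by (simp add: subst_minus)

lemma subst_power: "subst f (p ^ n) = subst f p ^ n"
  by (induction n) (simp_all add: subst_1 subst_mult)

lemma subst_numeral: "subst f (numeral n) = numeral n"
  by (metis Const_def single_numeral subst_Const)

lemma subst_sum: "subst f (sum p S) = (\<Sum>i\<in>S. subst f (p i))"
  by (induction S rule: infinite_finite_induct) (simp_all add: subst_0 subst_add)

lemmas subst_simps = subst_0 subst_1 subst_add subst_mult subst_minus subst_diff subst_power
  subst_numeral subst_Var subst_Const subst_smult subst_sum

lemma subst_monom_single: "subst_monom f (Poly_Mapping.single v n) = f v ^ n"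
  by (simp add: subst_monom_def)

lemma cpoly_eq_sum_single:
  fixes p :: "'v cpoly"
  shows "p = (\<Sum>m\<in>Poly_Mapping.keys p. Poly_Mapping.single m (Poly_Mapping.lookup p m))"
proof (rule poly_mapping_eqI)
  fix k
  show "Poly_Mapping.lookup p k = Poly_Mapping.lookup
      (\<Sum>m\<in>Poly_Mapping.keys p. Poly_Mapping.single m (Poly_Mapping.lookup p m)) k"
    by (simp add: lookup_sum lookup_single when_def sum.delta in_keys_iff)
qed

text \<open>Every polynomial arises from constants and variables by sums and products, so statements
  about algebra homomorphisms need checking only on those.\<close>

lemma cpoly_Var_induct [case_names Const Var add mult]:
  fixes p :: "'v cpoly"
  assumes C: "\<And>c. P (Const c)" and V: "\<And>v. P (Var v)"
    and A: "\<And>p q. P p \<Longrightarrow> P q \<Longrightarrow> P (p + q)"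
    and M: "\<And>p q. P p \<Longrightarrow> P q \<Longrightarrow> P (p * q)"
  shows "P p"
proof -
  have single1: "P (Poly_Mapping.single m 1)" for m :: "'v \<Rightarrow>\<^sub>0 nat"
  proof (induction m rule: update_induct)
    case const
    show ?case using C[of 1] by (simp add: Const_def)
  next
    case (update m v n)
    have pow: "P (Poly_Mapping.single (Poly_Mapping.single v k) 1)" for k
    proof (induction k)
      case 0
      show ?case using C[of 1] by (simp add: Const_def)
    next
      case (Suc k)
      have "Poly_Mapping.single (Poly_Mapping.single v (Suc k)) (1::complex)
          = Var v * Poly_Mapping.single (Poly_Mapping.single v k) 1"
        by (simp add: Var_def mult_single flip: single_add)
      then show ?case using M[OF V Suc.IH] by simp
    qed
    have "Poly_Mapping.update v n m = Poly_Mapping.single v n + m"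
      using update.hyps(1)
      by (intro poly_mapping_eqI)
         (auto simp: lookup_update lookup_add lookup_single in_keys_iff when_def)
    then have "Poly_Mapping.single (Poly_Mapping.update v n m) (1::complex)
        = Poly_Mapping.single (Poly_Mapping.single v n) 1 * Poly_Mapping.single m 1"
      by (simp add: mult_single)
    then show ?case using M[OF pow update.IH] by simp
  qed
  show ?thesis
  proof (induction p rule: cpoly_induct)
    case 0
    show ?case using C[of 0] by (simp add: Const_0)
  next
    case (add m c p)
    have "Poly_Mapping.single m c = Const c * Poly_Mapping.single m 1"
      by (simp add: Const_def mult_single)
    then show ?case using A[OF M[OF C single1] add.IH] by simp
  qed
qed

section \<open>Polynomials as functions on points\<close>

definition eval :: "('v \<Rightarrow> complex) \<Rightarrow> 'v cpoly \<Rightarrow> complex" where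
  "eval a p = Poly_Mapping.lookup (subst (\<lambda>v. Const (a v) :: 'v cpoly) p) 0"

text \<open>Reading off the coefficient at 0 loses nothing here, since substituting constants leaves
  a constant. This is what makes \<open>eval\<close> multiplicative.\<close>

lemma subst_Const_eval: "subst (\<lambda>v. Const (a v) :: 'v cpoly) (p :: 'v cpoly) = Const (eval a p)"
proof -
  obtain c where "subst (\<lambda>v. Const (a v) :: 'v cpoly) p = Const c"
  proof -
    have "\<exists>c. subst (\<lambda>v. Const (a v) :: 'v cpoly) p = Const c"
      by (induction p rule: cpoly_Var_induct)
         (auto simp: subst_simps simp flip: Const_add Const_mult)
    then show ?thesis using that by blast
  qed
  moreover have "Poly_Mapping.lookup (Const c :: 'v cpoly) 0 = c"
    by (simp add: Const_def)
  ultimately show ?thesis by (simp add: eval_def)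
qed

lemma eval_add: "eval a (p + q) = eval a p + eval a q"
  by (simp add: eval_def subst_add lookup_add)

lemma eval_mult: "eval a (p * q) = eval a p * eval a q"
proof -
  have "Const (eval a (p * q)) = (Const (eval a p * eval a q) :: 'a cpoly)"
    by (simp add: subst_mult Const_mult flip: subst_Const_eval)
  then show ?thesis by (simp add: Const_eq_iff)
qed

lemma eval_Const: "eval a (Const c) = c"
  by (simp add: eval_def subst_Const) (simp add: Const_def)

lemma eval_Var: "eval a (Var v) = a v"
  by (simp add: eval_def subst_Var) (simp add: Const_def)

lemma eval_0: "eval a 0 = 0" and eval_1: "eval a 1 = 1"
  using eval_Const[of a 0] eval_Const[of a 1] by (simp_all add: Const_0 Const_1)

lemma eval_minus: "eval a (- p) = - eval a p"
  by (simp add: eval_def subst_minus)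

lemma eval_diff: "eval a (p - q) = eval a p - eval a q"
  by (simp add: eval_def subst_diff lookup_minus)

lemma eval_power: "eval a (p ^ n) = eval a p ^ n"
  by (induction n) (simp_all add: eval_1 eval_mult)

lemma eval_numeral: "eval a (numeral n) = numeral n"
  by (metis Const_def single_numeral eval_Const)

lemma eval_smult: "eval a (smult c p) = c * eval a p"
  by (simp add: smult_def eval_mult eval_Const)

lemma eval_sum: "eval a (sum p S) = (\<Sum>i\<in>S. eval a (p i))"
  by (induction S rule: infinite_finite_induct) (simp_all add: eval_0 eval_add)

lemmas eval_simps = eval_0 eval_1 eval_add eval_mult eval_minus eval_diff eval_power eval_numeral
  eval_Var eval_Const eval_smult eval_sum

lemma eval_subst: "eval a (subst f p) = eval (\<lambda>v. eval a (f v)) p"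
  by (induction p rule: cpoly_Var_induct) (simp_all add: subst_simps eval_simps)

lemma eval_single:
  assumes "finite S" "Poly_Mapping.keys m \<subseteq> S"
  shows "eval a (Poly_Mapping.single m c) = c * (\<Prod>v\<in>S. a v ^ Poly_Mapping.lookup m v)"
proof -
  have "eval b (prod f S) = (\<Prod>v\<in>S. eval b (f v))" for b and f :: "'a \<Rightarrow> 'a cpoly"
    by (induction S rule: infinite_finite_induct) (simp_all add: eval_simps)
  moreover have "Poly_Mapping.single m c
      = smult c (subst_monom Var m :: 'a cpoly)"
  proof -
    have "subst Var p = p" for p :: "'a cpoly"
      by (induction p rule: cpoly_Var_induct) (simp_all add: subst_simps)
    then show ?thesis by (metis subst_single)
  qed
  ultimately show ?thesis
    by (simp add: subst_monom_superset[OF assms] eval_simps)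
qed

text \<open>Distinct monomials are linearly independent already as functions on the torus. The index
  set is arbitrary so that the lemma serves both polynomials themselves and the values of generator
  monomials at boundary points. Induction removes one monomial at a time.\<close>

lemma monomial_functions_independent:
  fixes c :: "'i \<Rightarrow> complex" and \<phi> :: "'i \<Rightarrow> 'v \<Rightarrow> nat"
  assumes "finite I" "finite V"
    and "\<And>i j. i \<in> I \<Longrightarrow> j \<in> I \<Longrightarrow> (\<And>v. v \<in> V \<Longrightarrow> \<phi> i v = \<phi> j v) \<Longrightarrow> i = j"
    and "\<And>a. (\<And>v. a v \<noteq> 0) \<Longrightarrow> (\<Sum>i\<in>I. c i * (\<Prod>v\<in>V. a v ^ \<phi> i v)) = 0"
    and "i \<in> I"
  shows "c i = 0"
  using assms(1,3,4,5)
proof (induction I arbitrary: c i rule: finite_induct)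
  case empty
  then show ?case by simp
next
  case (insert k J)
  have J: "c j = 0" if j: "j \<in> J" for j
  proof -
    obtain v where v: "v \<in> V" "\<phi> j v \<noteq> \<phi> k v"
      using insert.prems(1)[of j k] insert.hyps j by (metis insertCI)
    \<comment> \<open>Scaling the coordinate \<open>v\<close> by 2 and subtracting eliminates the monomial \<open>\<phi> k\<close>.\<close>
    let ?c = "\<lambda>i. c i * (2 ^ \<phi> i v - 2 ^ \<phi> k v)"
    have "?c j = 0"
    proof (rule insert.IH[where c = ?c and i = j])
      show "i = j" if "i \<in> J" "j \<in> J" "\<And>v. v \<in> V \<Longrightarrow> \<phi> i v = \<phi> j v" for i j
        using insert.prems(1) that by blast
      show "(\<Sum>i\<in>J. ?c i * (\<Prod>v\<in>V. a v ^ \<phi> i v)) = 0" if a: "\<And>v. a v \<noteq> 0" for a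
      proof -
        let ?b = "a(v := 2 * a v)"
        have b: "(\<Prod>w\<in>V. ?b w ^ \<phi> i w) = 2 ^ \<phi> i v * (\<Prod>w\<in>V. a w ^ \<phi> i w)" for i
        proof -
          have "(\<Prod>w\<in>V. ?b w ^ \<phi> i w)
              = (\<Prod>w\<in>V. (if w = v then 2 ^ \<phi> i v else 1) * a w ^ \<phi> i w)"
            by (rule prod.cong) (auto simp: power_mult_distrib)
          also have "\<dots> = 2 ^ \<phi> i v * (\<Prod>w\<in>V. a w ^ \<phi> i w)"
            using assms(2) v(1) by (simp add: prod.distrib prod.delta)
          finally show ?thesis .
        qed
        have "(\<Sum>i\<in>insert k J. ?c i * (\<Prod>v\<in>V. a v ^ \<phi> i v))
            = (\<Sum>i\<in>insert k J. c i * (\<Prod>w\<in>V. ?b w ^ \<phi> i w))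
              - 2 ^ \<phi> k v * (\<Sum>i\<in>insert k J. c i * (\<Prod>w\<in>V. a w ^ \<phi> i w))"
          unfolding b sum_distrib_left sum_subtractf[symmetric]
          by (rule sum.cong) (simp_all add: algebra_simps)
        also have "\<dots> = 0"
          using insert.prems(2)[of a] insert.prems(2)[of ?b] a by simp
        finally show ?thesis
          using insert.hyps by simp
      qed
    qed (use j in auto)
    moreover have "(2::complex) ^ \<phi> j v \<noteq> 2 ^ \<phi> k v"
    proof
      assume "(2::complex) ^ \<phi> j v = 2 ^ \<phi> k v"
      \<comment> \<open>Norms carry the equation to the reals, where the powers of 2 are
        distinct.\<close>
      then have "norm ((2::complex) ^ \<phi> j v) = norm ((2::complex) ^ \<phi> k v)" by simp
      then have "(2::real) ^ \<phi> j v = 2 ^ \<phi> k v" by (simp add: norm_power)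
      then show False using v(2) by simp
    qed
    ultimately show ?thesis by simp
  qed
  \<comment> \<open>Only the \<open>k\<close> term is left, and at the all-ones point its monomial
    equals 1.\<close>
  have "c k = 0"
    using insert.prems(2)[of "\<lambda>_. 1"] insert.hyps J by simp
  then show ?case using insert.prems(3) J by auto
qed

text \<open>Testing on the torus suffices, so later arguments may divide by the value of any
  variable, in particular by that of \<open>X 1 1 1\<close>.\<close>

lemma eval_eqI:
  fixes p q :: "'v::finite cpoly"
  assumes "\<And>a. (\<And>v. a v \<noteq> 0) \<Longrightarrow> eval a p = eval a q"
  shows "p = q"
proof -
  let ?r = "p - q"
  have "Poly_Mapping.lookup ?r m = 0" if "m \<in> Poly_Mapping.keys ?r" for m
  proof (rule monomial_functions_independent[of "Poly_Mapping.keys ?r" UNIV Poly_Mapping.lookup])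
    show "m = n" if "\<And>v. v \<in> UNIV \<Longrightarrow> Poly_Mapping.lookup m v = Poly_Mapping.lookup n v"
      for m n :: "'v \<Rightarrow>\<^sub>0 nat"
      using that by (intro poly_mapping_eqI) simp
    show "(\<Sum>m\<in>Poly_Mapping.keys ?r. Poly_Mapping.lookup ?r m
        * (\<Prod>v\<in>UNIV. a v ^ Poly_Mapping.lookup m v)) = 0" if "\<And>v. a v \<noteq> 0" for a
    proof -
      have "eval a ?r = eval a (\<Sum>m\<in>Poly_Mapping.keys ?r.
          Poly_Mapping.single m (Poly_Mapping.lookup ?r m))"
        using cpoly_eq_sum_single[of ?r] by (rule arg_cong)
      then show ?thesis
        using assms[OF that] by (simp add: eval_sum eval_diff eval_single[of UNIV])
    qed
  qed (use that in auto)
  then have "?r = 0"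
    by (intro poly_mapping_eqI) (metis in_keys_iff lookup_zero)
  then show ?thesis by simp
qed

lemma Var_mult_cancel:
  fixes p q :: "'v::finite cpoly"
  assumes "Var v * p = Var v * q"
  shows "p = q"
proof (rule eval_eqI)
  fix a :: "'v \<Rightarrow> complex"
  assume "\<And>v. a v \<noteq> 0"
  moreover have "a v * eval a p = a v * eval a q"
    using arg_cong[OF assms, of "eval a"] by (simp add: eval_simps)
  ultimately show "eval a p = eval a q" by simp
qed


section \<open>Polynomials in the generators\<close>

abbreviation rel :: "gen cpoly" where
  "rel \<equiv> Var F3 ^ 2 - (Var X111 ^ 2 * Var F4 - 4 * Var D12 * Var D13 * Var D23)"

text \<open>The letters \<open>a\<close> to \<open>h\<close> stand for the variables in
  lexicographic order of their indices. The factor after \<open>a ^ 2\<close> on the right is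
  Cayley's hyperdeterminant, that is \<open>f4\<close>.\<close>

lemma hyperdeterminant_identity:
  fixes a b c d e f g h :: "'a::comm_ring_1"
  shows "(a ^ 2 * h - a * b * g - a * c * f - a * d * e + 2 * b * c * e) ^ 2
    = a ^ 2 * (a ^ 2 * h ^ 2 - 2 * a * b * g * h - 2 * a * c * f * h - 2 * a * d * e * h
        + 4 * a * d * f * g + b ^ 2 * g ^ 2 + 4 * b * c * e * h - 2 * b * c * f * g
        - 2 * b * d * e * g + c ^ 2 * f ^ 2 - 2 * c * d * e * f + d ^ 2 * e ^ 2)
      - 4 * (a * g - c * e) * (a * f - b * e) * (a * d - b * c)"
  by (simp add: algebra_simps power2_eq_square)

lemma f3_squared: "f3 ^ 2 = X 1 1 1 ^ 2 * f4 - 4 * d12 * d13 * d23"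
  unfolding f3_def f4_def d12_def d13_def d23_def by (rule hyperdeterminant_identity)

lemma subst_rel: "subst gen_value rel = 0"
  by (simp add: subst_simps f3_squared)

section \<open>Normal forms modulo the relation\<close>

definition F3_reduced :: "gen cpoly \<Rightarrow> bool" where
  "F3_reduced r \<longleftrightarrow> (\<forall>m\<in>Poly_Mapping.keys r. Poly_Mapping.lookup m F3 \<le> 1)"

lemma F3_reduced_add: "F3_reduced p \<Longrightarrow> F3_reduced q \<Longrightarrow> F3_reduced (p + q)"
  unfolding F3_reduced_def using Poly_Mapping.keys_add[of p q] by blast

lemma F3_reduced_diff: "F3_reduced p \<Longrightarrow> F3_reduced q \<Longrightarrow> F3_reduced (p - q)"
  unfolding F3_reduced_def using keys_diff[of p q] by blast

lemma F3_reduced_0: "F3_reduced 0"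
  by (simp add: F3_reduced_def)

lemma F3_reduced_sum:
  "(\<And>i. i \<in> S \<Longrightarrow> F3_reduced (f i)) \<Longrightarrow> F3_reduced (sum f S)"
  by (induction S rule: infinite_finite_induct) (auto simp: F3_reduced_0 F3_reduced_add)

lemma F3_reduced_single: "Poly_Mapping.lookup m F3 \<le> 1 \<Longrightarrow> F3_reduced (Poly_Mapping.single m c)"
  by (simp add: F3_reduced_def)

text \<open>This is division with remainder by \<open>rel\<close>, which is monic of degree 2 in
  \<open>F3\<close>. Each rewriting of \<open>F3\<close>-squared lowers the exponent of
  \<open>F3\<close> by 2.\<close>

lemma single_reduction:
  "\<exists>q s. F3_reduced s \<and> Poly_Mapping.single m c = q * rel + s"
proof (induction "Poly_Mapping.lookup m F3" arbitrary: m c rule: less_induct)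
  case less
  show ?case
  proof (cases "Poly_Mapping.lookup m F3 \<le> 1")
    case True
    then show ?thesis
      by (intro exI[of _ 0] exI[of _ "Poly_Mapping.single m c"]) (simp add: F3_reduced_single)
  next
    case False
    \<comment> \<open>The truncated subtraction is exact, because the exponent of \<open>F3\<close>
      is at least 2 in this case. Below, \<open>?m1\<close> and \<open>?m2\<close> are
      \<open>n\<close> times the two monomials that replace \<open>F3\<close>-squared.\<close>
    define n where "n = m - Poly_Mapping.single F3 2"
    have m: "m = n + Poly_Mapping.single F3 2"
      using False by (intro poly_mapping_eqI)
        (auto simp: n_def lookup_add lookup_minus lookup_single when_def)
    let ?m1 = "n + (Poly_Mapping.single X111 2 + Poly_Mapping.single F4 1)"
    let ?m2 = "n + (Poly_Mapping.single D12 1 + Poly_Mapping.single D13 1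
      + Poly_Mapping.single D23 1)"
    have "Poly_Mapping.lookup ?m1 F3 < Poly_Mapping.lookup m F3"
      "Poly_Mapping.lookup ?m2 F3 < Poly_Mapping.lookup m F3"
      by (simp_all add: m lookup_add lookup_single when_def)
    then obtain q1 s1 q2 s2 where s: "F3_reduced s1" "F3_reduced s2"
      and q: "Poly_Mapping.single ?m1 c = q1 * rel + s1"
        "Poly_Mapping.single ?m2 (4 * c) = q2 * rel + s2"
      using less[of ?m1 c] less[of ?m2 "4 * c"] by blast
    have two: "Poly_Mapping.single x (2::nat) = Poly_Mapping.single x 1 + Poly_Mapping.single x 1"
      for x :: gen
      by (metis one_add_one single_add)
    have four: "(4 :: gen cpoly) = Poly_Mapping.single 0 4"
      by (metis single_numeral)
    have m0: "Poly_Mapping.single m c = Poly_Mapping.single n c * Var F3 ^ 2"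
      unfolding m Var_def power2_eq_square mult_single two by (simp add: add.assoc)
    have m1: "Poly_Mapping.single ?m1 c = Poly_Mapping.single n c * (Var X111 ^ 2 * Var F4)"
      unfolding Var_def power2_eq_square mult_single two by (simp add: add.assoc)
    have m2: "Poly_Mapping.single ?m2 (4 * c)
        = Poly_Mapping.single n c * (4 * Var D12 * Var D13 * Var D23)"
      unfolding Var_def four mult_single by (simp add: add.assoc mult.commute)
    have "Poly_Mapping.single m c = Poly_Mapping.single n c * rel
        + Poly_Mapping.single ?m1 c - Poly_Mapping.single ?m2 (4 * c)"
      unfolding m0 m1 m2 by (simp add: algebra_simps)
    also have "\<dots> = (Poly_Mapping.single n c + q1 - q2) * rel + (s1 - s2)"
      unfolding q by (simp add: algebra_simps)
    finally show ?thesis using F3_reduced_diff[OF s] by blast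
  qed
qed

lemma reduction:
  obtains q s where "F3_reduced s" "r = q * rel + s"
proof -
  have "\<exists>q s. F3_reduced s \<and> r = q * rel + s"
  proof (induction r rule: cpoly_induct)
    case 0
    show ?case
      by (intro exI[of _ 0]) (simp add: F3_reduced_0)
  next
    case (add m c p)
    from add.IH obtain q1 s1 where 1: "F3_reduced s1" "p = q1 * rel + s1" by blast
    obtain q2 s2 where 2: "F3_reduced s2" "Poly_Mapping.single m c = q2 * rel + s2"
      using single_reduction by blast
    have "Poly_Mapping.single m c + p = (q2 + q1) * rel + (s2 + s1)"
      by (simp add: 1 2 algebra_simps)
    then show ?case using F3_reduced_add[OF 2(1) 1(1)] by blast
  qed
  then show ?thesis using that by blast
qed

lemma range_subst_reduced:
  assumes "p \<in> range (subst gen_value)"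
  obtains s where "F3_reduced s" "p = subst gen_value s"
proof -
  from assms obtain r where r: "p = subst gen_value r" by blast
  obtain q s where s: "F3_reduced s" "r = q * rel + s" by (rule reduction)
  have "p = subst gen_value s"
    by (simp only: r s(2) subst_add subst_mult subst_rel) simp
  with s(1) show ?thesis by (rule that)
qed

lemma gen_UNIV: "(UNIV :: gen set) = {X111, D12, D13, D23, F3, F4}"
  using gen.exhaust by auto

text \<open>
  The values of the generators at the point with \<open>x\<^sub>2\<^sub>1\<^sub>1 = u\<close>, \<open>x\<^sub>1\<^sub>2\<^sub>1 = v\<close>, \<open>x\<^sub>1\<^sub>1\<^sub>2 = w\<close>, \<open>x\<^sub>2\<^sub>2\<^sub>2 = z\<close>
  and all other coordinates zero.
\<close>

fun boundary_value :: "complex \<Rightarrow> complex \<Rightarrow> complex \<Rightarrow> complex \<Rightarrow> gen \<Rightarrow> complex" where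
  "boundary_value u v w z X111 = 0"
| "boundary_value u v w z D12 = - (u * v)"
| "boundary_value u v w z D13 = - (u * w)"
| "boundary_value u v w z D23 = - (v * w)"
| "boundary_value u v w z F3 = 2 * (u * v * w)"
| "boundary_value u v w z F4 = 4 * (u * v * w * z)"

lemma eval_single_gen:
  "eval a (Poly_Mapping.single m c) = c * (\<Prod>x\<in>{X111, D12, D13, D23, F3, F4}.
     a x ^ Poly_Mapping.lookup m x)"
  by (rule eval_single, simp, simp flip: gen_UNIV)

text \<open>This separates the boundary values of reduced monomials. The bound on \<open>e\<close>
  matters: \<open>(1, 1, 1, 0)\<close> and \<open>(0, 0, 0, 2)\<close> have equal sums, which
  reflects the relation at \<open>X111 = 0\<close>.\<close>

lemma pairwise_sums_eq_imp_eq: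
  fixes b c d e b' c' d' e' :: nat
  assumes "b + c + e = b' + c' + e'" "b + d + e = b' + d' + e'" "c + d + e = c' + d' + e'"
    and "e \<le> 1" "e' \<le> 1"
  shows "b = b' \<and> c = c' \<and> d = d' \<and> e = e'"
proof -
  have "e = 0 \<or> e = 1" "e' = 0 \<or> e' = 1"
    using assms(4,5) by auto
  \<comment> \<open>Adding the three equations shows that \<open>e\<close> and \<open>e'\<close> have the same parity.\<close>
  have "3 * e + 2 * (b + c + d) = 3 * e' + 2 * (b' + c' + d')"
    using assms(1-3) by simp
  then have "even (3 * e + 2 * (b + c + d)) \<longleftrightarrow> even (3 * e' + 2 * (b' + c' + d'))"
    by (rule arg_cong)
  with \<open>e = 0 \<or> e = 1\<close> \<open>e' = 0 \<or> e' = 1\<close> have "e = e'" by auto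
  then show ?thesis using assms(1-3) by linarith
qed

text \<open>At boundary points the monomials containing \<open>X111\<close> vanish, and the other
  reduced monomials become nonzero multiples of distinct monomials in \<open>u\<close>,
  \<open>v\<close>, \<open>w\<close>, \<open>z\<close>. The latter therefore cannot occur in
  \<open>r\<close>.\<close>

lemma boundary_vanishing:
  assumes red: "F3_reduced r"
    and zero: "\<And>u v w z. u \<noteq> 0 \<Longrightarrow> v \<noteq> 0 \<Longrightarrow> w \<noteq> 0 \<Longrightarrow> z \<noteq> 0 \<Longrightarrow> eval (boundary_value u v w z) r = 0"
    and m: "m \<in> Poly_Mapping.keys r"
  shows "Poly_Mapping.lookup m X111 > 0"
proof (rule ccontr)
  assume "\<not> Poly_Mapping.lookup m X111 > 0"
  define l :: "(gen \<Rightarrow>\<^sub>0 nat) \<Rightarrow> gen \<Rightarrow> nat" where "l = Poly_Mapping.lookup"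
  define I where "I = {m \<in> Poly_Mapping.keys r. l m X111 = 0}"
  \<comment> \<open>The four entries are the exponents of \<open>u\<close>, \<open>v\<close>,
    \<open>w\<close>, \<open>z\<close> in the boundary value of \<open>m\<close>.\<close>
  define \<phi> where "\<phi> m i =
    [l m D12 + l m D13 + l m F3 + l m F4, l m D12 + l m D23 + l m F3 + l m F4,
     l m D13 + l m D23 + l m F3 + l m F4, l m F4] ! i" for m and i :: nat
  \<comment> \<open>The scalars -1, 2 and 4 from \<open>boundary_value\<close> are collected here.
    They are nonzero, so \<open>c m = 0\<close> contradicts \<open>m\<close> being a key of
    \<open>r\<close>.\<close>
  define c where "c m = Poly_Mapping.lookup r m
    * ((-1) ^ (l m D12 + l m D13 + l m D23) * 2 ^ l m F3 * 4 ^ l m F4)" for m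
  have "c m = 0"
  proof (rule monomial_functions_independent[of I "{0, 1, 2, 3}" \<phi> c m])
    show "finite I" by (simp add: I_def)
    show "m \<in> I" using m \<open>\<not> _\<close> by (simp add: I_def l_def)
  next
    fix i j assume ij: "i \<in> I" "j \<in> I" and eq: "\<And>v. v \<in> {0, 1, 2, 3} \<Longrightarrow> \<phi> i v = \<phi> j v"
    have "l i F3 \<le> 1" "l j F3 \<le> 1" "l i X111 = 0" "l j X111 = 0"
      using ij red by (auto simp: I_def F3_reduced_def l_def)
    moreover have eqs: "l i F4 = l j F4"
        "l i D12 + l i D13 + l i F3 = l j D12 + l j D13 + l j F3"
        "l i D12 + l i D23 + l i F3 = l j D12 + l j D23 + l j F3"
        "l i D13 + l i D23 + l i F3 = l j D13 + l j D23 + l j F3"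
      using eq[of 0] eq[of 1] eq[of 2] eq[of 3] by (simp_all add: \<phi>_def numeral_3_eq_3)
    ultimately have "l i D12 = l j D12 \<and> l i D13 = l j D13 \<and> l i D23 = l j D23 \<and> l i F3 = l j F3"
      by (intro pairwise_sums_eq_imp_eq)
    with \<open>l i X111 = 0\<close> \<open>l j X111 = 0\<close> eqs(1)
    have "l i x = l j x" for x by (cases x) auto
    then show "i = j" unfolding l_def by (rule poly_mapping_eqI)
  next
    fix a :: "nat \<Rightarrow> complex" assume a: "\<And>v. a v \<noteq> 0"
    let ?b = "boundary_value (a 0) (a 1) (a 2) (a 3)"
    have "(\<Sum>m\<in>I. c m * (\<Prod>v\<in>{0, 1, 2, 3}. a v ^ \<phi> m v))
        = (\<Sum>m\<in>I. eval ?b (Poly_Mapping.single m (Poly_Mapping.lookup r m)))"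
    proof (rule sum.cong)
      fix m assume "m \<in> I"
      then have "l m X111 = 0" by (simp add: I_def)
      then show "c m * (\<Prod>v\<in>{0, 1, 2, 3}. a v ^ \<phi> m v)
          = eval ?b (Poly_Mapping.single m (Poly_Mapping.lookup r m))"
        by (simp add: eval_single_gen c_def \<phi>_def l_def numeral_3_eq_3 power_add
            power_mult_distrib power_minus[of "_ * _"] mult_ac)
    qed simp
    also have "\<dots> = (\<Sum>m\<in>Poly_Mapping.keys r. eval ?b (Poly_Mapping.single m (Poly_Mapping.lookup r m)))"
      by (rule sum.mono_neutral_left)
         (auto simp: I_def l_def eval_single_gen)
    also have "\<dots> = eval ?b r"
      by (simp flip: eval_sum cpoly_eq_sum_single)
    also have "\<dots> = 0" using a by (intro zero)
    finally show "(\<Sum>m\<in>I. c m * (\<Prod>v\<in>{0, 1, 2, 3}. a v ^ \<phi> m v)) = 0" .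
  qed simp
  then show False using m by (simp add: c_def in_keys_iff)
qed

section \<open>Divisibility by \<open>X111\<close> and uniqueness of normal forms\<close>

lemma factor_X111:
  assumes red: "F3_reduced r"
    and pos: "\<And>m. m \<in> Poly_Mapping.keys r \<Longrightarrow> Poly_Mapping.lookup m X111 > 0"
  obtains s where "F3_reduced s" "r = Var X111 * s"
    "\<And>m. m \<in> Poly_Mapping.keys r \<Longrightarrow>
      \<exists>n\<in>Poly_Mapping.keys s. Poly_Mapping.lookup m X111 = Suc (Poly_Mapping.lookup n X111)"
proof
  let ?x = "Poly_Mapping.single X111 (1::nat)"
  let ?s = "\<Sum>m\<in>Poly_Mapping.keys r. Poly_Mapping.single (m - ?x) (Poly_Mapping.lookup r m)"
  show "F3_reduced ?s"
    using red by (intro F3_reduced_sum F3_reduced_single)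
      (auto simp: F3_reduced_def lookup_minus lookup_single when_def)
  have m: "?x + (m - ?x) = m" if "m \<in> Poly_Mapping.keys r" for m
    using pos[OF that] by (intro poly_mapping_eqI)
      (auto simp: lookup_add lookup_minus lookup_single when_def)
  have "Var X111 * ?s = (\<Sum>m\<in>Poly_Mapping.keys r. Poly_Mapping.single m (Poly_Mapping.lookup r m))"
    by (auto simp: sum_distrib_left Var_def mult_single m simp del: One_nat_def intro: sum.cong)
  then show r: "r = Var X111 * ?s"
    by (simp flip: cpoly_eq_sum_single)
  \<comment> \<open>The exact drop of the exponent by one drives the descent in
    \<open>subst_gen_value_inj\<close>.\<close>
  fix k assume "k \<in> Poly_Mapping.keys r"
  then have "k \<in> Poly_Mapping.keys (Var X111 * ?s)" using r by simp
  then obtain n where "n \<in> Poly_Mapping.keys ?s" "k = ?x + n"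
    using keys_mult[of "Var X111" ?s] by (auto simp: Var_def)
  then show "\<exists>n\<in>Poly_Mapping.keys ?s. Poly_Mapping.lookup k X111 = Suc (Poly_Mapping.lookup n X111)"
    by (intro bexI[of _ n]) (auto simp: lookup_add)
qed

fun boundary_point :: "complex \<Rightarrow> complex \<Rightarrow> complex \<Rightarrow> complex \<Rightarrow> index \<Rightarrow> complex" where
  "boundary_point u v w z (i, j, k) =
     (if (i, j, k) = (2, 1, 1) then u else if (i, j, k) = (1, 2, 1) then v
      else if (i, j, k) = (1, 1, 2) then w else if (i, j, k) = (2, 2, 2) then z else 0)"

lemma eval_boundary_point:
  "eval (boundary_point u v w z) (subst gen_value r) = eval (boundary_value u v w z) r"
proof -
  have "eval (boundary_point u v w z) (gen_value x) = boundary_value u v w z x" for x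
    by (cases x) (simp_all add: eval_simps d12_def d13_def d23_def f3_def f4_def)
  then show ?thesis by (simp add: eval_subst)
qed

text \<open>A value divisible by \<open>X 1 1 1\<close> vanishes at all boundary points, so
  \<open>r\<close> itself is divisible by \<open>X111\<close>; the factor then cancels from the
  value as well.\<close>

lemma divide_X111:
  assumes "F3_reduced r" "subst gen_value r = X 1 1 1 * p"
  obtains s where "F3_reduced s" "r = Var X111 * s" "subst gen_value s = p"
    "\<And>m. m \<in> Poly_Mapping.keys r \<Longrightarrow>
      \<exists>n\<in>Poly_Mapping.keys s. Poly_Mapping.lookup m X111 = Suc (Poly_Mapping.lookup n X111)"
proof -
  have "eval (boundary_value u v w z) r = 0" for u v w z
    using assms(2) by (simp add: eval_simps flip: eval_boundary_point)
  then have "\<And>m. m \<in> Poly_Mapping.keys r \<Longrightarrow> Poly_Mapping.lookup m X111 > 0"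
    by (rule boundary_vanishing[OF assms(1)])
  from factor_X111[OF assms(1) this] obtain s where s: "F3_reduced s" "r = Var X111 * s"
    "\<And>m. m \<in> Poly_Mapping.keys r \<Longrightarrow>
      \<exists>n\<in>Poly_Mapping.keys s. Poly_Mapping.lookup m X111 = Suc (Poly_Mapping.lookup n X111)"
    by metis
  have "X 1 1 1 * subst gen_value s = X 1 1 1 * p"
    using assms(2) by (simp add: s(2) subst_simps)
  then have "subst gen_value s = p" by (rule Var_mult_cancel)
  with s show ?thesis by (intro that)
qed

text \<open>Since 0 is \<open>X 1 1 1\<close> times 0, division by \<open>X111\<close> can be
  repeated forever. A monomial of \<open>r\<close> would thus have an \<open>X111\<close>-exponent
  above every \<open>n\<close>.\<close>

lemma subst_gen_value_inj:
  assumes "F3_reduced r" "subst gen_value r = 0"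
  shows "r = 0"
proof -
  have "n \<le> Poly_Mapping.lookup m X111"
    if "F3_reduced r" "subst gen_value r = 0" "m \<in> Poly_Mapping.keys r" for n m r
    using that
  proof (induction n arbitrary: m r)
    case 0
    show ?case by simp
  next
    case (Suc n)
    obtain s where s: "F3_reduced s" "subst gen_value s = 0"
      "\<exists>n\<in>Poly_Mapping.keys s. Poly_Mapping.lookup m X111 = Suc (Poly_Mapping.lookup n X111)"
      using divide_X111[of r 0] Suc.prems by (metis mult_zero_right)
    then show ?case using Suc.IH[OF s(1,2)] by fastforce
  qed
  then have "Poly_Mapping.keys r = {}"
    using assms by (metis all_not_in_conv not_less_eq_eq order_refl)
  then show ?thesis by simp
qed

text \<open>The remainder of a relation modulo \<open>rel\<close> is reduced with value 0, hence it
  is 0.\<close>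

lemma relation_ideal_eq: "relation_ideal = principal_ideal rel"
proof (intro subset_antisym subsetI)
  fix r assume "r \<in> relation_ideal"
  then have r0: "subst gen_value r = 0" by (simp add: relation_ideal_def)
  obtain q s where s: "F3_reduced s" "r = q * rel + s" by (rule reduction)
  have "subst gen_value s = 0"
    using r0 by (simp only: s(2) subst_add subst_mult subst_rel) simp
  then have "s = 0" using s(1) by (intro subst_gen_value_inj)
  then show "r \<in> principal_ideal rel" using s(2) by (auto simp: principal_ideal_def)
next
  fix r assume "r \<in> principal_ideal rel"
  then obtain q where "r = q * rel" by (auto simp: principal_ideal_def)
  then show "r \<in> relation_ideal"
    by (simp only: relation_ideal_def mem_Collect_eq subst_mult subst_rel) simp
qed

section \<open>Generated subalgebras as images of substitution\<close>

lemma subspace_range_subst: "cpoly.subspace (range (subst f))"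
  unfolding cpoly.subspace_def
  by (auto simp flip: subst_add subst_smult intro: rev_image_eqI[of 0] simp: subst_0)

lemma subalgebra_range_subst: "subalgebra (range (subst f))"
  unfolding subalgebra_def using subspace_range_subst[of f]
  by (auto simp flip: subst_mult intro: rev_image_eqI[of 1] simp: subst_1)

lemma subalgebra_hull_range: "subalgebra hull (range f) = range (subst f)"
proof (rule hull_unique)
  show "range f \<subseteq> range (subst f)"
    by (metis image_subsetI rangeI subst_Var)
  fix A assume A: "range f \<subseteq> A" "subalgebra A"
  have closed: "cpoly.subspace A" "1 \<in> A" "\<And>p q. p \<in> A \<Longrightarrow> q \<in> A \<Longrightarrow> p * q \<in> A"
    using A(2) by (auto simp: subalgebra_def)
  have "subst f p \<in> A" for p
  proof (induction p rule: cpoly_Var_induct)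
    case (Const c)
    have "smult c 1 \<in> A" using closed(1,2) by (rule cpoly.subspace_scale)
    then show ?case by (simp add: subst_Const smult_def)
  next
    case (Var v)
    then show ?case using A(1) by (auto simp: subst_Var)
  next
    case (add p q)
    then show ?case using closed(1) by (simp add: subst_add cpoly.subspace_add)
  next
    case (mult p q)
    then show ?case using closed(3) by (simp add: subst_mult)
  qed
  then show "range (subst f) \<subseteq> A" by blast
qed (rule subalgebra_range_subst)

lemma range_gen_value: "range gen_value = {X 1 1 1, d12, d13, d23, f3, f4}"
  by (simp add: gen_UNIV)

section \<open>The monomial basis of the generated algebra\<close>

fun gen_exponent :: "nat \<times> nat \<times> nat \<times> nat \<times> nat \<times> nat \<Rightarrow> (gen \<Rightarrow>\<^sub>0 nat)" where
  "gen_exponent (a, b, c, d, e, g) =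
     Poly_Mapping.single X111 a + Poly_Mapping.single D12 b + Poly_Mapping.single D13 c
     + Poly_Mapping.single D23 d + Poly_Mapping.single F3 e + Poly_Mapping.single F4 g"

lemma lookup_gen_exponent:
  "Poly_Mapping.lookup (gen_exponent (a, b, c, d, e, g)) x =
    (case x of X111 \<Rightarrow> a | D12 \<Rightarrow> b | D13 \<Rightarrow> c | D23 \<Rightarrow> d | F3 \<Rightarrow> e | F4 \<Rightarrow> g)"
  by (cases x) (simp_all add: lookup_add lookup_single when_def)

lemma inj_gen_exponent: "inj gen_exponent"
proof (rule injI)
  fix s t assume eq: "gen_exponent s = gen_exponent t"
  obtain a b c d e g a' b' c' d' e' g' where
    st: "s = (a, b, c, d, e, g)" "t = (a', b', c', d', e', g')"
    by (metis prod.exhaust)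
  have "Poly_Mapping.lookup (gen_exponent s) x = Poly_Mapping.lookup (gen_exponent t) x" for x
    by (simp add: eq)
  from this[of X111] this[of D12] this[of D13] this[of D23] this[of F3] this[of F4]
  show "s = t" unfolding st lookup_gen_exponent by simp
qed

lemma gen_exponent_lookup:
  "gen_exponent (Poly_Mapping.lookup m X111, Poly_Mapping.lookup m D12, Poly_Mapping.lookup m D13,
     Poly_Mapping.lookup m D23, Poly_Mapping.lookup m F3, Poly_Mapping.lookup m F4) = m"
proof (rule poly_mapping_eqI)
  show "Poly_Mapping.lookup (gen_exponent (Poly_Mapping.lookup m X111, Poly_Mapping.lookup m D12,
     Poly_Mapping.lookup m D13, Poly_Mapping.lookup m D23, Poly_Mapping.lookup m F3,
     Poly_Mapping.lookup m F4)) x = Poly_Mapping.lookup m x" for x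
    unfolding lookup_gen_exponent by (cases x) simp_all
qed

lemma subst_gen_exponent:
  "subst gen_value (Poly_Mapping.single (gen_exponent t) c) = smult c (gen_monomial t)"
  by (cases t) (simp add: subst_single subst_monom_add subst_monom_single)

lemma F3_reduced_gen_exponent:
  "t \<in> basis_exponents \<Longrightarrow> F3_reduced (Poly_Mapping.single (gen_exponent t) c)"
  by (cases t) (auto intro!: F3_reduced_single
      simp: basis_exponents_def lookup_gen_exponent simp del: gen_exponent.simps)

lemma inj_gen_monomial: "inj_on gen_monomial basis_exponents"
proof (rule inj_onI)
  fix s t assume st: "s \<in> basis_exponents" "t \<in> basis_exponents" "gen_monomial s = gen_monomial t"
  have "Poly_Mapping.single (gen_exponent s) (1::complex) - Poly_Mapping.single (gen_exponent t) 1 = 0"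
    using st by (intro subst_gen_value_inj F3_reduced_diff F3_reduced_gen_exponent)
      (simp_all add: subst_diff subst_gen_exponent)
  then have "Poly_Mapping.lookup (Poly_Mapping.single (gen_exponent s) (1::complex)) (gen_exponent t) = 1"
    by simp
  then have "gen_exponent s = gen_exponent t"
    by (simp add: lookup_single when_def split: if_splits)
  then show "s = t" by (rule injD[OF inj_gen_exponent])
qed

text \<open>A linear dependency lifts to a reduced polynomial \<open>r\<close> in the generator
  names with the same coefficients. Its value is 0, so \<open>r\<close> and all the coefficients
  vanish.\<close>

lemma independent_gen_monomial: "cpoly.independent (gen_monomial ` basis_exponents)"
proof
  assume "cpoly.dependent (gen_monomial ` basis_exponents)"
  then obtain T u where T: "finite T" "T \<subseteq> gen_monomial ` basis_exponents"
    "(\<Sum>p\<in>T. smult (u p) p) = 0" "\<exists>p\<in>T. u p \<noteq> 0"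
    unfolding cpoly.dependent_explicit by auto
  obtain B where B: "B \<subseteq> basis_exponents" "finite B" "T = gen_monomial ` B"
    using T(1,2) by (meson finite_subset_image)
  define r where "r = (\<Sum>t\<in>B. Poly_Mapping.single (gen_exponent t) (u (gen_monomial t)))"
  \<comment> \<open>Injectivity turns the sum over the set \<open>T\<close> of products into a sum
    over exponents.\<close>
  have "inj_on gen_monomial B" using inj_gen_monomial B(1) by (rule inj_on_subset)
  then have "subst gen_value r = 0"
    using T(3) by (simp add: r_def subst_sum subst_gen_exponent B(3) sum.reindex)
  moreover have "F3_reduced r"
    unfolding r_def using B(1) by (intro F3_reduced_sum F3_reduced_gen_exponent) auto
  ultimately have "r = 0" by (intro subst_gen_value_inj)
  have "u (gen_monomial t) = 0" if "t \<in> B" for t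
  proof -
    have "Poly_Mapping.lookup r (gen_exponent t) = (\<Sum>s\<in>B. if s = t then u (gen_monomial s) else 0)"
      unfolding r_def lookup_sum
      by (rule sum.cong) (auto simp: lookup_single when_def dest: injD[OF inj_gen_exponent])
    then show ?thesis using \<open>r = 0\<close> that B(2) by simp
  qed
  then show False using T(4) B(3) by auto
qed

text \<open>Any value has a reduced preimage, and the monomials of a reduced polynomial are exactly
  of the form \<open>gen_exponent t\<close> with \<open>t\<close> in
  \<open>basis_exponents\<close>.\<close>

lemma span_gen_monomial: "cpoly.span (gen_monomial ` basis_exponents) = range (subst gen_value)"
proof (intro subset_antisym cpoly.span_minimal subspace_range_subst)
  show "gen_monomial ` basis_exponents \<subseteq> range (subst gen_value)"
  proof
    fix p assume "p \<in> gen_monomial ` basis_exponents"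
    then obtain t where "p = gen_monomial t" by blast
    then have "p = subst gen_value (Poly_Mapping.single (gen_exponent t) 1)"
      by (simp add: subst_gen_exponent)
    then show "p \<in> range (subst gen_value)" by blast
  qed
  show "range (subst gen_value) \<subseteq> cpoly.span (gen_monomial ` basis_exponents)"
  proof
    fix p assume "p \<in> range (subst gen_value)"
    then obtain s where s: "F3_reduced s" "p = subst gen_value s" by (rule range_subst_reduced)
    have "subst gen_value (Poly_Mapping.single m c) \<in> cpoly.span (gen_monomial ` basis_exponents)"
      if m: "m \<in> Poly_Mapping.keys s" for m c
    proof -
      obtain t where t: "t \<in> basis_exponents" "gen_exponent t = m"
      proof
        have "Poly_Mapping.lookup m F3 \<in> {0, 1}"
          using s(1) m by (fastforce simp: F3_reduced_def)
        then show "(Poly_Mapping.lookup m X111, Poly_Mapping.lookup m D12,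
          Poly_Mapping.lookup m D13, Poly_Mapping.lookup m D23, Poly_Mapping.lookup m F3,
          Poly_Mapping.lookup m F4) \<in> basis_exponents"
          by (simp add: basis_exponents_def)
      qed (rule gen_exponent_lookup)
      have "subst gen_value (Poly_Mapping.single m c) = smult c (gen_monomial t)"
        unfolding t(2)[symmetric] by (rule subst_gen_exponent)
      then show ?thesis
        using t(1) by (simp add: cpoly.span_scale cpoly.span_base)
    qed
    then have "subst gen_value (\<Sum>m\<in>Poly_Mapping.keys s. Poly_Mapping.single m (Poly_Mapping.lookup s m))
        \<in> cpoly.span (gen_monomial ` basis_exponents)"
      unfolding subst_sum by (intro cpoly.span_sum)
    then show "p \<in> cpoly.span (gen_monomial ` basis_exponents)"
      by (simp add: s(2) flip: cpoly_eq_sum_single)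
  qed
qed


section \<open>Invariants\<close>

text \<open>The transposed matrices act on points, so that acting on a polynomial amounts to
  precomposition.\<close>

fun act_point :: "mat2 \<times> mat2 \<times> mat2 \<Rightarrow> (index \<Rightarrow> complex) \<Rightarrow> index \<Rightarrow> complex" where
  "act_point (A, B, C) a (i, j, k) =
     (\<Sum>p\<in>UNIV. \<Sum>q\<in>UNIV. \<Sum>r\<in>UNIV. A $ p $ i * B $ q $ j * C $ r $ k * a (p, q, r))"

lemma eval_act: "eval a (act g p) = eval (act_point g a) p"
proof (cases g)
  case (fields A B C)
  have "(\<lambda>v. eval a (case v of (i, j, k) \<Rightarrow> \<Sum>p\<in>UNIV. \<Sum>q\<in>UNIV. \<Sum>r\<in>UNIV.
      smult (A $ p $ i * B $ q $ j * C $ r $ k) (X p q r))) = act_point g a"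
    by (auto simp: fun_eq_iff fields eval_simps)
  then show ?thesis by (simp add: fields eval_subst)
qed

lemma act_mult: "act g (p * q) = act g p * act g q"
  by (cases g) (simp add: subst_mult)

lemma act_subst_gen_value:
  assumes "\<And>x. act g (gen_value x) = gen_value x"
  shows "act g (subst gen_value r) = subst gen_value r"
  by (cases g; induction r rule: cpoly_Var_induct)
     (use assms in \<open>simp_all add: subst_simps\<close>)

lemma act_point_upper:
  assumes "A \<in> U2" "B \<in> U2" "C \<in> U2"
  defines "s \<equiv> A $ 1 $ 2" and "t \<equiv> B $ 1 $ 2" and "r \<equiv> C $ 1 $ 2"
  shows "act_point (A, B, C) a (1, 1, 1) = a (1, 1, 1)"
    "act_point (A, B, C) a (2, 1, 1) = a (2, 1, 1) + s * a (1, 1, 1)"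
    "act_point (A, B, C) a (1, 2, 1) = a (1, 2, 1) + t * a (1, 1, 1)"
    "act_point (A, B, C) a (1, 1, 2) = a (1, 1, 2) + r * a (1, 1, 1)"
    "act_point (A, B, C) a (2, 2, 1)
      = a (2, 2, 1) + s * a (1, 2, 1) + t * a (2, 1, 1) + s * t * a (1, 1, 1)"
    "act_point (A, B, C) a (2, 1, 2)
      = a (2, 1, 2) + s * a (1, 1, 2) + r * a (2, 1, 1) + s * r * a (1, 1, 1)"
    "act_point (A, B, C) a (1, 2, 2)
      = a (1, 2, 2) + t * a (1, 1, 2) + r * a (1, 2, 1) + t * r * a (1, 1, 1)"
    "act_point (A, B, C) a (2, 2, 2)
      = a (2, 2, 2) + s * a (1, 2, 2) + t * a (2, 1, 2) + r * a (2, 2, 1)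
        + s * t * a (1, 1, 2) + s * r * a (1, 2, 1) + t * r * a (2, 1, 1)
        + s * t * r * a (1, 1, 1)"
  using assms by (simp_all add: U2_def sum_2 algebra_simps)

lemma gen_value_invariant:
  assumes "g \<in> N"
  shows "act g (gen_value x) = gen_value x"
proof -
  obtain A B C where g: "g = (A, B, C)" and U: "A \<in> U2" "B \<in> U2" "C \<in> U2"
    using assms by (auto simp: N_def)
  note pt = act_point_upper[OF U]
  have x: "act g (X 1 1 1) = X 1 1 1"
    by (rule eval_eqI) (simp only: g eval_act eval_simps pt)
  have d12: "act g d12 = d12"
  proof (rule eval_eqI)
    show "eval a (act g d12) = eval a d12" for a
      unfolding g eval_act d12_def eval_simps pt by algebra
  qed
  have d13: "act g d13 = d13"
  proof (rule eval_eqI)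
    show "eval a (act g d13) = eval a d13" for a
      unfolding g eval_act d13_def eval_simps pt by algebra
  qed
  have d23: "act g d23 = d23"
  proof (rule eval_eqI)
    show "eval a (act g d23) = eval a d23" for a
      unfolding g eval_act d23_def eval_simps pt by algebra
  qed
  have f3: "act g f3 = f3"
  proof (rule eval_eqI)
    show "eval a (act g f3) = eval a f3" for a
      unfolding g eval_act f3_def eval_simps pt by algebra
  qed
  \<comment> \<open>Instead of expanding the quartic, the relation writes \<open>X 1 1 1\<close>
    squared times \<open>f4\<close> in terms of polynomials already known to be fixed; then
    \<open>X 1 1 1\<close> is cancelled twice.\<close>
  have f4: "act g f4 = f4"
  proof -
    have rel: "X 1 1 1 * (X 1 1 1 * f4) = f3 * f3 + 4 * d12 * d13 * d23"
      using f3_squared by (simp add: power2_eq_square mult.assoc)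
    have "X 1 1 1 * (X 1 1 1 * act g f4) = act g (X 1 1 1 * (X 1 1 1 * f4))"
      by (simp only: act_mult x)
    also have "\<dots> = act g (f3 * f3 + 4 * d12 * d13 * d23)"
      by (simp only: rel)
    also have "\<dots> = f3 * f3 + 4 * d12 * d13 * d23"
      using f3 d12 d13 d23 by (simp add: g subst_simps)
    also have "\<dots> = X 1 1 1 * (X 1 1 1 * f4)"
      by (simp only: rel)
    finally have "X 1 1 1 * (X 1 1 1 * act g f4) = X 1 1 1 * (X 1 1 1 * f4)" .
    then show ?thesis by (blast dest: Var_mult_cancel)
  qed
  show ?thesis
    using x d12 d13 d23 f3 f4 by (cases x) simp_all
qed

section \<open>The slice and the clearing of denominators\<close>

fun slice_point :: "(index \<Rightarrow> complex) \<Rightarrow> index \<Rightarrow> complex" where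
  "slice_point a (i, j, k) =
     (if (i, j, k) = (1, 1, 1) then a (1, 1, 1)
      else if (i, j, k) = (2, 2, 1) then eval a d12 / a (1, 1, 1)
      else if (i, j, k) = (2, 1, 2) then eval a d13 / a (1, 1, 1)
      else if (i, j, k) = (1, 2, 2) then eval a d23 / a (1, 1, 1)
      else if (i, j, k) = (2, 2, 2) then eval a f3 / a (1, 1, 1) ^ 2
      else 0)"

lemma eval_invariant:
  assumes p: "p \<in> invariants N" and a: "a (1, 1, 1) \<noteq> 0"
  shows "eval a p = eval (slice_point a) p"
proof -
  define u :: "complex \<Rightarrow> mat2" where "u s = vector [vector [1, s], vector [0, 1]]" for s
  have U: "u s \<in> U2" and u12: "u s $ 1 $ 2 = s" for s
    by (simp_all add: u_def U2_def)
  let ?x = "a (1, 1, 1)"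
  \<comment> \<open>By \<open>act_point_upper\<close>, an upper entry \<open>s\<close> in the first
    factor adds \<open>s * ?x\<close> to the coordinate at \<open>(2, 1, 1)\<close>, and similarly
    for the other two. These entries clear all three coordinates.\<close>
  define g where "g = (u (- a (2, 1, 1) / ?x), u (- a (1, 2, 1) / ?x), u (- a (1, 1, 2) / ?x))"
  note pt = act_point_upper[OF U U U, unfolded u12]
  have "act_point g a (i, j, k) = slice_point a (i, j, k)" for i j k
    using exhaust_2[of i] exhaust_2[of j] exhaust_2[of k] a
    by (elim disjE) (simp_all only: g_def pt,
        simp_all add: eval_simps d12_def d13_def d23_def f3_def field_simps power2_eq_square)
  then have "act_point g a = slice_point a" by auto
  moreover have "act g p = p" using p U by (simp add: invariants_def g_def N_def del: act.simps)
  ultimately show ?thesis by (metis eval_act)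
qed

text \<open>The slice coordinates are generators divided by powers of \<open>X 1 1 1\<close>. The
  exponent \<open>m\<close> and the polynomial \<open>r\<close> are uniform in \<open>a\<close>,
  which turns the pointwise identity into one of polynomials.\<close>

lemma eval_slice_point:
  "\<exists>m r. \<forall>a. a (1, 1, 1) \<noteq> 0 \<longrightarrow>
     a (1, 1, 1) ^ m * eval (slice_point a) p = eval a (subst gen_value r)"
proof (induction p rule: cpoly_Var_induct)
  case (Const c)
  show ?case
    by (rule exI[of _ 0], rule exI[of _ "Const c"]) (simp add: subst_simps eval_simps)
next
  case (Var v)
  obtain i j k where v: "v = (i, j, k)" by (metis prod.exhaust)
  \<comment> \<open>The largest denominator is the square of \<open>a (1, 1, 1)\<close>, so
    \<open>r\<close> represents that square times the slice coordinate.\<close>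
  define r :: "gen cpoly" where "r =
     (if v = (1, 1, 1) then Var X111 ^ 3
      else if v = (2, 2, 1) then Var X111 * Var D12
      else if v = (2, 1, 2) then Var X111 * Var D13
      else if v = (1, 2, 2) then Var X111 * Var D23
      else if v = (2, 2, 2) then Var F3
      else 0)"
  show ?case
    by (rule exI[of _ 2], rule exI[of _ r])
       (auto simp: r_def v subst_simps eval_simps power2_eq_square power3_eq_cube)
next
  case (add p q)
  then obtain m r n s where *: "\<forall>a. a (1, 1, 1) \<noteq> 0 \<longrightarrow>
     a (1, 1, 1) ^ m * eval (slice_point a) p = eval a (subst gen_value r)"
    "\<forall>a. a (1, 1, 1) \<noteq> 0 \<longrightarrow>
     a (1, 1, 1) ^ n * eval (slice_point a) q = eval a (subst gen_value s)"
    by blast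
  show ?case
    by (rule exI[of _ "m + n"], rule exI[of _ "Var X111 ^ n * r + Var X111 ^ m * s"])
       (simp add: subst_simps eval_simps power_add algebra_simps flip: *[rule_format])
next
  case (mult p q)
  then obtain m r n s where *: "\<forall>a. a (1, 1, 1) \<noteq> 0 \<longrightarrow>
     a (1, 1, 1) ^ m * eval (slice_point a) p = eval a (subst gen_value r)"
    "\<forall>a. a (1, 1, 1) \<noteq> 0 \<longrightarrow>
     a (1, 1, 1) ^ n * eval (slice_point a) q = eval a (subst gen_value s)"
    by blast
  show ?case
    by (rule exI[of _ "m + n"], rule exI[of _ "r * s"])
       (simp add: subst_simps eval_simps power_add algebra_simps flip: *[rule_format])
qed

text \<open>This removes the power of \<open>X 1 1 1\<close> introduced by clearing denominators: a
  reduced preimage can be divided by \<open>X111\<close> once for each factor.\<close>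

lemma range_subst_saturated:
  assumes "X 1 1 1 ^ m * p \<in> range (subst gen_value)"
  shows "p \<in> range (subst gen_value)"
  using assms
proof (induction m)
  case 0
  then show ?case by simp
next
  case (Suc m)
  obtain r where r: "F3_reduced r" "X 1 1 1 ^ Suc m * p = subst gen_value r"
    using Suc.prems by (rule range_subst_reduced)
  have "subst gen_value r = X 1 1 1 * (X 1 1 1 ^ m * p)"
    unfolding r(2)[symmetric] by (simp only: power_Suc mult.assoc)
  with r(1) obtain s where s: "subst gen_value s = X 1 1 1 ^ m * p" by (rule divide_X111)
  show ?case by (rule Suc.IH) (simp only: s[symmetric] rangeI)
qed

lemma invariants_eq: "invariants N = range (subst gen_value)"
proof (intro subset_antisym subsetI)
  fix p assume p: "p \<in> invariants N"
  obtain m r where r: "\<And>a. a (1, 1, 1) \<noteq> 0 \<Longrightarrow>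
     a (1, 1, 1) ^ m * eval (slice_point a) p = eval a (subst gen_value r)"
    using eval_slice_point[of p] by blast
  \<comment> \<open>It is enough to compare values on the torus, where \<open>eval_invariant\<close>
    moves the point to the slice.\<close>
  have "X 1 1 1 ^ m * p = subst gen_value r"
  proof (rule eval_eqI)
    fix a :: "index \<Rightarrow> complex" assume "\<And>v. a v \<noteq> 0"
    then show "eval a (X 1 1 1 ^ m * p) = eval a (subst gen_value r)"
      by (simp only: eval_mult eval_power eval_Var eval_invariant[OF p] r[symmetric] not_False_eq_True)
  qed
  then show "p \<in> range (subst gen_value)"
    by (intro range_subst_saturated[of m p]) (simp only: rangeI)
next
  fix p assume "p \<in> range (subst gen_value)"
  then obtain r where p: "p = subst gen_value r" by blast
  have "act g p = p" if "g \<in> N" for g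
    unfolding p using gen_value_invariant[OF that] by (rule act_subst_gen_value)
  then show "p \<in> invariants N" by (simp only: invariants_def mem_Collect_eq Ball_def) blast
qed

theorem proposition2p4:
  shows "(inj_on gen_monomial basis_exponents
      \<and> cpoly.independent (gen_monomial ` basis_exponents)
      \<and> cpoly.span (gen_monomial ` basis_exponents) = invariants N)
    \<and> subalgebra hull {X 1 1 1, d12, d13, d23, f3, f4} = invariants N
    \<and> f3 ^ 2 = X 1 1 1 ^ 2 * f4 - 4 * d12 * d13 * d23
    \<and> relation_ideal
      = principal_ideal (Var F3 ^ 2 - (Var X111 ^ 2 * Var F4 - 4 * Var D12 * Var D13 * Var D23))"
  using inj_gen_monomial independent_gen_monomial span_gen_monomial
    subalgebra_hull_range[of gen_value] f3_squared relation_ideal_eq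
  by (simp add: invariants_eq range_gen_value)

end
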